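(* Let $P_{(2,2)}$ be the set of all cylindric partitions with profile $c=(2,2)$. Then, as formal power series in $q$, $$\sum_{\Lambda\in P_{(2,2)}} q^{|\Lambda|}=\left(1+\sum_{n\ge1}\frac{2\,q^{n(n+1)}(-q^2;q^2)_{n-1}}{(q^2;q^2)_n\,(-q;q^2)_n}\right)\frac{(-q;q^2)_\infty}{(q;q)_\infty}.$$
   Context: Let $r,\ell$ be positive integers and $c=(c_1,\dots,c_r)$ a composition of $\ell$ into $r$ nonnegative integer parts (zero entries allowed). A cylindric partition with profile $c$ is a tuple $\Lambda=(\lambda^{(1)},\dots,\lambda^{(r)})$ of ordinary partitions $\lambda^{(i)}=(\lambda^{(i)}_1\ge\lambda^{(i)}_2\ge\cdots)$ (parts beyond the length are taken to be $0$) such that for all $i,j$: $\lambda^{(i)}_j\ge\lambda^{(i+1)}_{j+c_{i+1}}$ for $1\le i\le r-1$, and $\lambda^{(r)}_j\ge\lambda^{(1)}_{j+c_1}$. The size $|\Lambda|$ is the sum of all parts of all $\lambda^{(i)}$; the empty cylindric partition is included with size $0$. Notation: $(a;q)_n=\prod_{k=1}^n(1-aq^{k-1})$ (so $(a;q)_0=1$), $(a;q)_\infty=\lim_{n\to\infty}(a;q)_n$. *)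

theory Defs
  imports "HOL-Analysis.Infinite_Sum" "HOL-Computational_Algebra.Formal_Power_Series"
begin

(* A partition is the list of its positive parts, so that every partition has exactly one
   representation. *)
definition is_partition :: "nat list \<Rightarrow> bool" where
  "is_partition \<mu> \<longleftrightarrow> sorted_wrt (\<ge>) \<mu> \<and> 0 \<notin> set \<mu>"

(* The j-th part, counted from j = 1; the value at the unused index j = 0 has no meaning. *)
definition part :: "nat list \<Rightarrow> nat \<Rightarrow> nat" where
  "part \<mu> j = (if j - 1 < length \<mu> then \<mu> ! (j - 1) else 0)"

(* Lists are indexed from 0: the i-th partition of the tuple is \<Lambda> ! (i - 1), and the i-th entry
   of the profile is c ! (i - 1). *)
definition cylindric_partitions :: "nat list \<Rightarrow> nat list list set" where
  "cylindric_partitions c =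
    {\<Lambda>. length \<Lambda> = length c \<and> (\<forall>\<mu> \<in> set \<Lambda>. is_partition \<mu>) \<and>
       (\<forall>i j. 1 \<le> i \<longrightarrow> i \<le> length c - 1 \<longrightarrow> 1 \<le> j \<longrightarrow>
          part (\<Lambda> ! (i - 1)) j \<ge> part (\<Lambda> ! i) (j + c ! i)) \<and>
       (\<forall>j. 1 \<le> j \<longrightarrow>
          part (\<Lambda> ! (length c - 1)) j \<ge> part (\<Lambda> ! 0) (j + c ! 0))}"

definition cp_size :: "nat list list \<Rightarrow> nat" where
  "cp_size \<Lambda> = (\<Sum>\<mu>\<leftarrow>\<Lambda>. sum_list \<mu>)"

definition qpoch :: "'a::comm_ring_1 \<Rightarrow> 'a \<Rightarrow> nat \<Rightarrow> 'a" where
  "qpoch a q n = (\<Prod>k=1..n. 1 - a * q ^ (k - 1))"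

(* On formal power series the limit is the one of the usual metric topology, in which
   convergence means that every coefficient is eventually constant. *)
definition qpoch_inf :: "'a::{comm_ring_1,t2_space} \<Rightarrow> 'a \<Rightarrow> 'a" where
  "qpoch_inf a q = lim (\<lambda>n. qpoch a q n)"

end

theory Submission
  imports Defs
begin

text \<open>
  Let $V(a,b)$ count the cylindric partitions $(\lambda,\mu)$ of profile $(2,2)$ in which $\lambda$ has at
  most $a$ and $\mu$ at most $b$ parts. Since the lengths of $\lambda$ and $\mu$ differ by at most 2,
  subtracting 1 from every part and inclusion-exclusion give
  $(1-q^{a+b})V(a,b)=V(a-1,b)+V(a,b-1)-V(a-1,b-1)$ for $|a-b|\le 2$, and also
  $(1-q^{2m})V(m+1,m-1)=V(m,m-1)$. For $\alpha_m=(q;q)_{2m}V(m,m)$ and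
  $\beta_m=(q;q)_{2m-1}V(m,m-1)$ this becomes
  $\beta_{m+1}=\alpha_m+q^{2m}\beta_m$ and $\alpha_{m+1}=(1+q^{2m+1})\alpha_m+2q^{2m}\beta_m$.
  The limit of $\alpha_m$ is $(q;q)_\infty$ times the wanted series. It is computed by solving the dual
  recurrence
  $X_k=(1+q^{2k+1})X_{k+1}+q^{2k+2}X_{k+1}+q^{2k+2}(1-q^{2k+3})X_{k+2}$ with $X_k\to 1$, for which
  $\lim\alpha_m=X_0$. Its solution is $X_k=\sum_n t_n q^{2kn}(-q^{2k+2n+1};q^2)_\infty$ with
  $t_n=q^{n(n+1)}(-1;q^2)_n/(q^2;q^2)_n$.
\<close>

unbundle fps_syntax

subsection \<open>Limits and sums of formal power series\<close>

lemma tendsto_fps_mult: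
  fixes a b :: "'a :: ring fps"
  assumes "(f \<longlongrightarrow> a) F" and "(g \<longlongrightarrow> b) F"
  shows "((\<lambda>x. f x * g x) \<longlongrightarrow> a * b) F"
proof (rule tendsto_fpsI)
  fix n
  have "\<forall>\<^sub>F x in F. \<forall>i\<in>{..n}. f x $ i = a $ i" "\<forall>\<^sub>F x in F. \<forall>i\<in>{..n}. g x $ i = b $ i"
    using assms by (auto intro!: eventually_ball_finite simp: tendsto_fps_iff)
  then show "\<forall>\<^sub>F x in F. (f x * g x) $ n = (a * b) $ n"
    by eventually_elim (auto simp: fps_mult_nth intro!: sum.cong)
qed

lemma tendsto_fps_add:
  fixes a b :: "'a :: ab_group_add fps"
  assumes "(f \<longlongrightarrow> a) F" and "(g \<longlongrightarrow> b) F"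
  shows "((\<lambda>x. f x + g x) \<longlongrightarrow> a + b) F"
proof (rule tendsto_fpsI)
  fix n
  have "\<forall>\<^sub>F x in F. f x $ n = a $ n" "\<forall>\<^sub>F x in F. g x $ n = b $ n"
    using assms by (auto simp: tendsto_fps_iff)
  then show "\<forall>\<^sub>F x in F. (f x + g x) $ n = (a + b) $ n"
    by eventually_elim simp
qed

text \<open>As \<open>q\<close> has no constant term, \<open>q ^ n\<close> starts in degree n or
  later. The bounds below on where a term can start to contribute rest on this.\<close>

lemma fps_mult_power_nth_eq_0:
  fixes q :: "'a :: comm_ring_1 fps"
  assumes "q $ 0 = 0" and "i < n"
  shows "(f * q ^ n) $ i = 0"
  using assms startsby_zero_power_prefix[of q n] by (simp add: fps_mult_nth)

text \<open>Only indices n <= i reach degree i, so each coefficient is a finite sum. This form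
  evaluates the infinite sum of the theorem; \<open>fps_partial_sums_tendsto\<close> is its
  counterpart for limits of partial sums.\<close>

lemma fps_has_sum_of_subdegree:
  fixes f :: "nat \<Rightarrow> 'a :: ab_group_add fps"
  assumes "\<And>n i. i < n \<Longrightarrow> f n $ i = 0"
  shows "(f has_sum Abs_fps (\<lambda>i. \<Sum>n\<in>A \<inter> {..i}. f n $ i)) A"
proof (rule has_sum_fpsI)
  fix i
  have sub: "{n \<in> A. f n $ i \<noteq> 0} \<subseteq> A \<inter> {..i}"
    using assms by (force simp: not_less)
  then show "finite {n \<in> A. f n $ i \<noteq> 0}"
    by (rule finite_subset) auto
  show "Abs_fps (\<lambda>i. \<Sum>n\<in>A \<inter> {..i}. f n $ i) $ i = (\<Sum>n | n \<in> A \<and> f n $ i \<noteq> 0. f n $ i)"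
    using sub by (auto intro!: sum.mono_neutral_right)
qed

lemma fps_partial_sums_tendsto:
  fixes f :: "nat \<Rightarrow> 'a :: ab_group_add fps"
  assumes "\<And>n i. i < n \<Longrightarrow> f n $ i = 0"
  shows "(\<lambda>N. \<Sum>n<N. f n) \<longlonglongrightarrow> Abs_fps (\<lambda>i. \<Sum>n\<le>i. f n $ i)"
proof (rule tendsto_fpsI)
  fix i
  show "\<forall>\<^sub>F N in sequentially.
          (\<Sum>n<N. f n) $ i = Abs_fps (\<lambda>i. \<Sum>n\<le>i. f n $ i) $ i"
    using eventually_gt_at_top[of i]
  proof eventually_elim
    case (elim N)
    have "(\<Sum>n<N. f n $ i) = (\<Sum>n\<le>i. f n $ i)"
      using elim assms by (intro sum.mono_neutral_right) auto
    then show ?case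
      by (simp add: fps_sum_nth)
  qed
qed

subsection \<open>Pochhammer symbols\<close>

lemma qpoch_0 [simp]: "qpoch a q 0 = 1"
  by (simp add: qpoch_def)

lemma qpoch_Suc: "qpoch a q (Suc n) = qpoch a q n * (1 - a * q ^ n)"
  by (simp add: qpoch_def)

lemma qpoch_nth_0:
  fixes a q :: "'a :: comm_ring_1 fps"
  assumes "a $ 0 = 0"
  shows "qpoch a q n $ 0 = 1"
  using assms by (induction n) (simp_all add: qpoch_Suc)

lemma qpoch_tendsto:
  fixes a q :: "'a :: comm_ring_1 fps"
  assumes "q $ 0 = 0"
  shows "qpoch a q \<longlonglongrightarrow> qpoch_inf a q"
proof -
  \<comment> \<open>The factor 1 - a q^n changes only degrees from n on, so coefficient i is final
    from n = i + 1 on.\<close>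
  have stable: "qpoch a q n $ i = qpoch a q (Suc i) $ i" if "Suc i \<le> n" for n i
    using that
  proof (induction n rule: dec_induct)
    case (step n)
    have "qpoch a q (Suc n) = qpoch a q n - (qpoch a q n * a) * q ^ n"
      by (simp add: qpoch_Suc algebra_simps)
    moreover have "(qpoch a q n * a * q ^ n) $ i = 0"
      using assms step.hyps by (intro fps_mult_power_nth_eq_0) auto
    ultimately have "qpoch a q (Suc n) $ i = qpoch a q n $ i"
      by (simp only: fps_sub_nth diff_zero)
    then show ?case
      using step.IH by (rule trans)
  qed simp
  have "qpoch a q \<longlonglongrightarrow> Abs_fps (\<lambda>i. qpoch a q (Suc i) $ i)"
  proof (rule tendsto_fpsI)
    fix i
    show "\<forall>\<^sub>F n in sequentially.
            qpoch a q n $ i = Abs_fps (\<lambda>i. qpoch a q (Suc i) $ i) $ i"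
      using eventually_ge_at_top[of "Suc i"]
      unfolding fps_nth_Abs_fps by eventually_elim (rule stable)
  qed
  then show ?thesis
    by (simp add: qpoch_inf_def limI)
qed

lemma qpoch_inf_nth_0:
  fixes a q :: "'a :: comm_ring_1 fps"
  assumes "a $ 0 = 0" and "q $ 0 = 0"
  shows "qpoch_inf a q $ 0 = 1"
proof -
  have "\<forall>\<^sub>F n in sequentially. qpoch a q n $ 0 = qpoch_inf a q $ 0"
    using qpoch_tendsto[OF assms(2)] by (simp add: tendsto_fps_iff)
  then show ?thesis
    using assms(1) by (simp add: qpoch_nth_0)
qed

subsection \<open>Partitions and their columns\<close>

lemma part_eq_0_iff:
  assumes "is_partition \<mu>"
  shows "part \<mu> (Suc a) = 0 \<longleftrightarrow> length \<mu> \<le> a"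
proof -
  have "\<mu> ! a \<noteq> 0" if "a < length \<mu>"
    using assms that unfolding is_partition_def by (metis nth_mem)
  then show ?thesis
    by (auto simp: part_def)
qed

lemma part_antimono:
  assumes "is_partition \<mu>" and "1 \<le> i" and "i \<le> j"
  shows "part \<mu> j \<le> part \<mu> i"
proof (cases "i = j")
  case False
  then have "i - 1 < j - 1"
    using assms by linarith
  then show ?thesis
    using assms by (auto simp: part_def is_partition_def sorted_wrt_iff_nth_less)
qed simp

lemma partition_eqI:
  assumes "is_partition \<mu>" "is_partition \<nu>" and "\<And>j. part \<mu> (Suc j) = part \<nu> (Suc j)"
  shows "\<mu> = \<nu>"
proof -
  have "length \<mu> \<le> a \<longleftrightarrow> length \<nu> \<le> a" for a
    using assms part_eq_0_iff by metis
  then have len: "length \<mu> = length \<nu>"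
    by (meson le_antisym order_refl)
  show ?thesis
  proof (rule nth_equalityI[OF len])
    fix j assume "j < length \<mu>"
    then show "\<mu> ! j = \<nu> ! j"
      using assms(3)[of j] len by (simp add: part_def)
  qed
qed

lemma partition_of_fun:
  assumes "\<And>i j. i \<le> j \<Longrightarrow> f j \<le> f i" and "\<And>j. a \<le> j \<Longrightarrow> f j = 0"
  shows "\<exists>\<mu>. is_partition \<mu> \<and> length \<mu> \<le> a \<and> (\<forall>j. part \<mu> (Suc j) = f j)"
  using assms(2)
proof (induction a)
  case 0
  then show ?case
    by (intro exI[of _ "[]"]) (auto simp: is_partition_def part_def)
next
  case (Suc a)
  show ?case
  proof (cases "f a = 0")
    case True
    then have "\<And>j. a \<le> j \<Longrightarrow> f j = 0"
      using assms(1) by (metis le_zero_eq)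
    then show ?thesis
      using Suc.IH le_SucI by blast
  next
    case False
    have "f i \<noteq> 0" if "i < Suc a" for i
      using False assms(1)[of i a] that by auto
    then have "is_partition (map f [0..<Suc a])"
      using assms(1) unfolding is_partition_def
      by (auto simp: sorted_wrt_iff_nth_less simp del: upt_Suc) (metis less_irrefl)
    moreover have "part (map f [0..<Suc a]) (Suc j) = f j" for j
      using Suc.prems by (auto simp: part_def simp del: upt_Suc)
    ultimately show ?thesis
      by (intro exI[of _ "map f [0..<Suc a]"]) auto
  qed
qed

lemma sum_list_eq_sum_part:
  assumes "length \<mu> \<le> a"
  shows "sum_list \<mu> = (\<Sum>j<a. part \<mu> (Suc j))"
proof -
  have "sum_list \<mu> = (\<Sum>j<length \<mu>. part \<mu> (Suc j))"
    by (simp add: sum_list_sum_nth part_def atLeast0LessThan)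
  also have "\<dots> = (\<Sum>j<a. part \<mu> (Suc j))"
    using assms by (intro sum.mono_neutral_left) (auto simp: part_def)
  finally show ?thesis .
qed

lemma partition_length_le:
  assumes "is_partition \<mu>"
  shows "length \<mu> \<le> sum_list \<mu>"
proof -
  have "0 \<notin> set \<mu> \<Longrightarrow> length \<mu> \<le> sum_list \<mu>"
    by (induction \<mu>) auto
  then show ?thesis
    using assms by (simp add: is_partition_def)
qed

text \<open>For \<open>length \<mu> \<le> a\<close> this puts a column of height a in front of the
  Young diagram: missing parts count as 0 and become 1, so the new length is exactly a.\<close>

definition add_column :: "nat \<Rightarrow> nat list \<Rightarrow> nat list" where
  "add_column a \<mu> = map (\<lambda>j. Suc (part \<mu> (Suc j))) [0..<a]"

lemma length_add_column [simp]: "length (add_column a \<mu>) = a"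
  by (simp add: add_column_def)

lemma part_add_column:
  "part (add_column a \<mu>) (Suc j) = (if j < a then Suc (part \<mu> (Suc j)) else 0)"
  by (simp add: add_column_def part_def)

lemma is_partition_add_column:
  assumes "is_partition \<mu>"
  shows "is_partition (add_column a \<mu>)"
  using assms unfolding is_partition_def[of "add_column a \<mu>"]
  by (auto simp: add_column_def sorted_wrt_iff_nth_less part_antimono)

lemma sum_list_add_column:
  assumes "length \<mu> \<le> a"
  shows "sum_list (add_column a \<mu>) = a + sum_list \<mu>"
  using assms
  by (simp add: sum_list_eq_sum_part[of _ a] part_add_column sum_Suc)

lemma add_column_inj:
  assumes "is_partition \<mu>" "is_partition \<nu>" "length \<mu> \<le> a" "length \<nu> \<le> a"
    and "add_column a \<mu> = add_column a \<nu>"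
  shows "\<mu> = \<nu>"
proof (rule partition_eqI[OF assms(1,2)])
  fix j
  show "part \<mu> (Suc j) = part \<nu> (Suc j)"
  proof (cases "j < a")
    case True
    then show ?thesis
      using arg_cong[OF assms(5), of "\<lambda>\<rho>. part \<rho> (Suc j)"] by (simp add: part_add_column)
  next
    case False
    then show ?thesis
      using assms(3,4) by (simp add: part_def)
  qed
qed

text \<open>The first column is removed; truncated subtraction keeps the parts past the end at 0.
  The formula for the parts is exported so that interlacing can be checked on them.\<close>

lemma add_column_surj:
  assumes "is_partition \<nu>"
  obtains \<mu> where "is_partition \<mu>" "length \<mu> \<le> length \<nu>" "add_column (length \<nu>) \<mu> = \<nu>"
    "\<And>j. part \<mu> (Suc j) = part \<nu> (Suc j) - 1"
proof -
  have "\<exists>\<mu>. is_partition \<mu> \<and> length \<mu> \<le> length \<nu> \<and>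
          (\<forall>j. part \<mu> (Suc j) = part \<nu> (Suc j) - 1)"
  proof (rule partition_of_fun)
    show "part \<nu> (Suc j) - 1 \<le> part \<nu> (Suc i) - 1" if "i \<le> j" for i j
      using part_antimono[OF assms, of "Suc i" "Suc j"] that by (simp add: diff_le_mono)
  qed (simp add: part_def)
  then obtain \<mu> where \<mu>: "is_partition \<mu>" "length \<mu> \<le> length \<nu>"
    "\<And>j. part \<mu> (Suc j) = part \<nu> (Suc j) - 1"
    by auto
  have "add_column (length \<nu>) \<mu> = \<nu>"
  proof (rule nth_equalityI)
    fix j assume j: "j < length (add_column (length \<nu>) \<mu>)"
    then have "\<nu> ! j \<noteq> 0"
      using assms unfolding is_partition_def by (metis length_add_column nth_mem)
    then show "add_column (length \<nu>) \<mu> ! j = \<nu> ! j"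
      using j by (simp add: add_column_def \<mu>(3)) (simp add: part_def)
  qed simp
  with \<mu> that show thesis
    by blast
qed

subsection \<open>Generating functions of cylindric partitions\<close>

text \<open>Since the listed parts are positive, size n bounds every part and every length by
  n.\<close>

lemma finite_cylindric_partitions_of_size:
  "finite {\<Lambda> \<in> cylindric_partitions c. cp_size \<Lambda> = n}"
proof (rule finite_subset)
  let ?P = "{\<mu> :: nat list. set \<mu> \<subseteq> {..n} \<and> length \<mu> \<le> n}"
  show "{\<Lambda> \<in> cylindric_partitions c. cp_size \<Lambda> = n}
          \<subseteq> {\<Lambda>. set \<Lambda> \<subseteq> ?P \<and> length \<Lambda> = length c}"
  proof clarsimp
    fix \<Lambda> assume \<Lambda>: "\<Lambda> \<in> cylindric_partitions c" "n = cp_size \<Lambda>"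
    have "set \<mu> \<subseteq> {..cp_size \<Lambda>} \<and> length \<mu> \<le> cp_size \<Lambda>" if "\<mu> \<in> set \<Lambda>" for \<mu>
    proof -
      have "is_partition \<mu>"
        using \<Lambda> that by (auto simp: cylindric_partitions_def)
      moreover have "sum_list \<mu> \<le> cp_size \<Lambda>"
        using that by (auto simp: cp_size_def intro: member_le_sum_list)
      ultimately show ?thesis
        using partition_length_le[of \<mu>] member_le_sum_list[of _ \<mu>] by fastforce
    qed
    then show "set \<Lambda> \<subseteq> {\<mu>. set \<mu> \<subseteq> {..cp_size \<Lambda>} \<and> length \<mu> \<le> cp_size \<Lambda>} \<and>
        length \<Lambda> = length c"
      using \<Lambda> by (auto simp: cylindric_partitions_def)
  qed
  show "finite {\<Lambda>. set \<Lambda> \<subseteq> ?P \<and> length \<Lambda> = length c}"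
    by (intro finite_lists_length_eq finite_lists_length_le) auto
qed

definition gf :: "nat list list set \<Rightarrow> 'a :: comm_ring_1 fps" where
  "gf S = Abs_fps (\<lambda>n. of_nat (card {\<Lambda> \<in> S. cp_size \<Lambda> = n}))"

lemma has_sum_gf:
  assumes "\<And>n. finite {\<Lambda> \<in> S. cp_size \<Lambda> = n}"
  shows "((\<lambda>\<Lambda>. fps_X ^ cp_size \<Lambda>) has_sum (gf S :: 'a :: comm_ring_1 fps)) S"
proof (rule has_sum_fpsI)
  fix n
  have eq: "{\<Lambda> \<in> S. (fps_X ^ cp_size \<Lambda> :: 'a fps) $ n \<noteq> 0} = {\<Lambda> \<in> S. cp_size \<Lambda> = n}"
    by auto
  then show "finite {\<Lambda> \<in> S. (fps_X ^ cp_size \<Lambda> :: 'a fps) $ n \<noteq> 0}"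
    using assms by simp
  show "(gf S :: 'a fps) $ n
      = (\<Sum>\<Lambda> | \<Lambda> \<in> S \<and> (fps_X ^ cp_size \<Lambda> :: 'a fps) $ n \<noteq> 0. (fps_X ^ cp_size \<Lambda>) $ n)"
    unfolding eq by (simp add: gf_def)
qed

lemma gf_Un:
  assumes "\<And>n. finite {\<Lambda> \<in> A \<union> B. cp_size \<Lambda> = n}"
  shows "gf (A \<union> B) + gf (A \<inter> B) = gf A + gf B"
proof (rule fps_ext)
  fix n
  let ?F = "\<lambda>S. {\<Lambda> \<in> S. cp_size \<Lambda> = n}"
  have "finite (?F A)" "finite (?F B)"
    using assms[of n] by (auto elim!: rev_finite_subset)
  then have "card (?F A) + card (?F B) = card (?F A \<union> ?F B) + card (?F A \<inter> ?F B)"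
    by (rule card_Un_Int)
  also have "?F A \<union> ?F B = ?F (A \<union> B)" by auto
  also have "?F A \<inter> ?F B = ?F (A \<inter> B)" by auto
  finally show "(gf (A \<union> B) + gf (A \<inter> B)) $ n = (gf A + gf B) $ n"
    by (simp add: gf_def flip: of_nat_add)
qed

lemma gf_empty [simp]: "gf {} = 0"
  by (simp add: gf_def fps_zero_def)

lemma gf_image:
  assumes "inj_on f S" and "\<And>\<Lambda>. \<Lambda> \<in> S \<Longrightarrow> cp_size (f \<Lambda>) = k + cp_size \<Lambda>"
  shows "gf (f ` S) = fps_X ^ k * gf S"
proof (rule fps_ext)
  fix n
  have eq: "{\<Lambda> \<in> f ` S. cp_size \<Lambda> = n} = f ` {\<Lambda> \<in> S. k + cp_size \<Lambda> = n}"
    using assms(2) by auto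
  have "inj_on f {\<Lambda> \<in> S. k + cp_size \<Lambda> = n}"
    by (rule inj_on_subset[OF assms(1)]) auto
  then have "card {\<Lambda> \<in> f ` S. cp_size \<Lambda> = n} = card {\<Lambda> \<in> S. k + cp_size \<Lambda> = n}"
    unfolding eq by (rule card_image)
  also have "\<dots> = (if n < k then 0 else card {\<Lambda> \<in> S. cp_size \<Lambda> = n - k})"
    by (auto intro!: arg_cong[where f = card])
  finally show "gf (f ` S) $ n = (fps_X ^ k * gf S) $ n"
    by (simp add: gf_def fps_X_power_mult_nth)
qed

section \<open>Profile (2,2) with bounded lengths: the series V(a,b)\<close>

definition cp_box :: "nat \<Rightarrow> nat \<Rightarrow> nat list list set" where
  "cp_box a b = {\<Lambda> \<in> cylindric_partitions [2, 2]. length (\<Lambda> ! 0) \<le> a \<and> length (\<Lambda> ! 1) \<le> b}"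

text \<open>Both entries of the profile are 2, so the two cylindric conditions are this one relation
  with its arguments exchanged. The index j starts at 0 here, hence \<open>Suc j\<close>.\<close>

definition interlaced :: "nat list \<Rightarrow> nat list \<Rightarrow> bool" where
  "interlaced \<mu> \<nu> \<longleftrightarrow> (\<forall>j. part \<nu> (Suc (Suc (Suc j))) \<le> part \<mu> (Suc j))"

lemma all_ge_1_iff: "(\<forall>j. 1 \<le> j \<longrightarrow> P j) \<longleftrightarrow> (\<forall>j. P (Suc j))"
  by (auto simp: Suc_le_eq gr0_conv_Suc)

lemma cylindric_partitions_22_iff:
  "\<Lambda> \<in> cylindric_partitions [2, 2] \<longleftrightarrow>
     (\<exists>\<mu> \<nu>. \<Lambda> = [\<mu>, \<nu>] \<and> is_partition \<mu> \<and> is_partition \<nu> \<and> interlaced \<mu> \<nu> \<and> interlaced \<nu> \<mu>)"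
proof (cases "\<exists>\<mu> \<nu>. \<Lambda> = [\<mu>, \<nu>]")
  case True
  then obtain \<mu> \<nu> where \<Lambda>: "\<Lambda> = [\<mu>, \<nu>]"
    by blast
  have "\<Lambda> \<in> cylindric_partitions [2, 2] \<longleftrightarrow> is_partition \<mu> \<and> is_partition \<nu> \<and>
      (\<forall>j. 1 \<le> j \<longrightarrow> part \<nu> (Suc (Suc j)) \<le> part \<mu> j) \<and>
      (\<forall>j. 1 \<le> j \<longrightarrow> part \<mu> (Suc (Suc j)) \<le> part \<nu> j)"
    unfolding cylindric_partitions_def mem_Collect_eq \<Lambda> by simp
  then show ?thesis
    by (simp only: all_ge_1_iff \<Lambda> interlaced_def list.inject) blast
next
  case False
  then have "length \<Lambda> \<noteq> 2"
    by (auto simp: length_Suc_conv numeral_2_eq_2)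
  then show ?thesis
    using False by (auto simp: cylindric_partitions_def)
qed

lemma mem_cp_box_iff:
  "\<Lambda> \<in> cp_box a b \<longleftrightarrow>
     (\<exists>\<mu> \<nu>. \<Lambda> = [\<mu>, \<nu>] \<and> is_partition \<mu> \<and> is_partition \<nu> \<and> interlaced \<mu> \<nu> \<and> interlaced \<nu> \<mu> \<and>
        length \<mu> \<le> a \<and> length \<nu> \<le> b)"
  unfolding cp_box_def using cylindric_partitions_22_iff by auto

text \<open>The first vanishing part of \<mu> forces the part of \<nu> two places further on to
  vanish.\<close>

lemma interlaced_length:
  assumes "is_partition \<mu>" "is_partition \<nu>" "interlaced \<mu> \<nu>"
  shows "length \<nu> \<le> length \<mu> + 2"
proof -
  have "part \<mu> (Suc (length \<mu>)) = 0"
    using part_eq_0_iff[OF assms(1)] by simp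
  then have "part \<nu> (Suc (length \<mu> + 2)) = 0"
    using assms(3) unfolding interlaced_def by (metis add_2_eq_Suc' le_zero_eq)
  then show ?thesis
    using part_eq_0_iff[OF assms(2)] by blast
qed

text \<open>Raising both sides of an inequality by 1 preserves it. It could fail only where the
  right side is raised and the left is not, that is for j + 2 < b and a <= j, which b <= a + 2
  excludes.\<close>

lemma interlaced_add_column:
  assumes "interlaced \<mu> \<nu>" and "b \<le> a + 2"
  shows "interlaced (add_column a \<mu>) (add_column b \<nu>)"
  using assms by (auto simp: interlaced_def part_add_column)

lemma finite_cp_box_of_size: "finite {\<Lambda> \<in> cp_box a b. cp_size \<Lambda> = n}"
  by (rule finite_subset[OF _ finite_cylindric_partitions_of_size[of "[2, 2]" n]])
     (auto simp: cp_box_def)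

text \<open>Adding a first column of height a and one of height b is a bijection from the whole box
  onto the pairs attaining both length bounds, and adds a + b to the size.\<close>

lemma gf_full_box:
  assumes "a \<le> b + 2" and "b \<le> a + 2"
  shows "gf {\<Lambda> \<in> cp_box a b. length (\<Lambda> ! 0) = a \<and> length (\<Lambda> ! 1) = b}
           = fps_X ^ (a + b) * gf (cp_box a b)"
proof -
  define f where "f \<Lambda> = [add_column a (\<Lambda> ! 0), add_column b (\<Lambda> ! 1)]" for \<Lambda>
  have "f ` cp_box a b = {\<Lambda> \<in> cp_box a b. length (\<Lambda> ! 0) = a \<and> length (\<Lambda> ! 1) = b}"
    (is "_ = ?R")
  proof (intro equalityI subsetI)
    fix \<Lambda> assume "\<Lambda> \<in> f ` cp_box a b"
    then show "\<Lambda> \<in> ?R"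
      using assms
      by (auto simp: f_def mem_cp_box_iff is_partition_add_column interlaced_add_column)
  next
    fix \<Lambda> assume "\<Lambda> \<in> ?R"
    then obtain \<mu> \<nu> where \<Lambda>: "\<Lambda> = [\<mu>, \<nu>]" "is_partition \<mu>" "is_partition \<nu>"
      "interlaced \<mu> \<nu>" "interlaced \<nu> \<mu>" "length \<mu> = a" "length \<nu> = b"
      by (auto simp: mem_cp_box_iff)
    obtain \<mu>' where \<mu>': "is_partition \<mu>'" "length \<mu>' \<le> a" "add_column a \<mu>' = \<mu>"
      "\<And>j. part \<mu>' (Suc j) = part \<mu> (Suc j) - 1"
      using add_column_surj[OF \<Lambda>(2)] \<Lambda>(6) by blast
    obtain \<nu>' where \<nu>': "is_partition \<nu>'" "length \<nu>' \<le> b" "add_column b \<nu>' = \<nu>"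
      "\<And>j. part \<nu>' (Suc j) = part \<nu> (Suc j) - 1"
      using add_column_surj[OF \<Lambda>(3)] \<Lambda>(7) by blast
    \<comment> \<open>Truncated subtraction of 1 is monotone, so the inequalities survive.\<close>
    have "interlaced \<mu>' \<nu>'" "interlaced \<nu>' \<mu>'"
      using \<Lambda>(4,5) by (auto simp: interlaced_def \<mu>'(4) \<nu>'(4) diff_le_mono)
    then have "[\<mu>', \<nu>'] \<in> cp_box a b" "\<Lambda> = f [\<mu>', \<nu>']"
      using \<mu>' \<nu>' \<Lambda>(1) by (auto simp: mem_cp_box_iff f_def)
    then show "\<Lambda> \<in> f ` cp_box a b"
      by blast
  qed
  moreover have "inj_on f (cp_box a b)"
    by (auto simp: inj_on_def f_def mem_cp_box_iff) (metis add_column_inj)+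
  moreover have "cp_size (f \<Lambda>) = a + b + cp_size \<Lambda>" if "\<Lambda> \<in> cp_box a b" for \<Lambda>
    using that by (auto simp: f_def mem_cp_box_iff cp_size_def sum_list_add_column)
  ultimately show ?thesis
    using gf_image[of f "cp_box a b" "a + b"] by simp
qed

text \<open>The box splits into pairs attaining both bounds, counted by \<open>gf_full_box\<close>,
  and the union of two smaller boxes meeting in \<open>cp_box a b\<close>, counted by
  inclusion-exclusion.\<close>

lemma gf_cp_box_Suc_Suc:
  assumes "a \<le> b + 2" and "b \<le> a + 2"
  shows "(1 - fps_X ^ (Suc a + Suc b)) * gf (cp_box (Suc a) (Suc b))
           = gf (cp_box a (Suc b)) + gf (cp_box (Suc a) b) - (gf (cp_box a b) :: 'a :: comm_ring_1 fps)"
proof -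
  let ?gf = "gf :: _ \<Rightarrow> 'a fps"
  let ?F = "{\<Lambda> \<in> cp_box (Suc a) (Suc b). length (\<Lambda> ! 0) = Suc a \<and> length (\<Lambda> ! 1) = Suc b}"
  let ?G = "cp_box a (Suc b) \<union> cp_box (Suc a) b"
  have box: "cp_box (Suc a) (Suc b) = ?F \<union> ?G" and "?F \<inter> ?G = {}"
    and int: "cp_box a (Suc b) \<inter> cp_box (Suc a) b = cp_box a b"
    by (auto simp: cp_box_def)
  then have V: "?gf (cp_box (Suc a) (Suc b)) = ?gf ?F + ?gf ?G"
    using gf_Un[of ?F ?G] finite_cp_box_of_size[of "Suc a" "Suc b"] by simp
  have G: "?gf ?G + ?gf (cp_box a b) = ?gf (cp_box a (Suc b)) + ?gf (cp_box (Suc a) b)"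
  proof -
    have "finite {\<Lambda> \<in> ?G. cp_size \<Lambda> = n}" for n
      by (rule finite_subset[OF _ finite_cp_box_of_size[of "Suc a" "Suc b" n]])
         (auto simp: cp_box_def)
    then show ?thesis
      using gf_Un[of "cp_box a (Suc b)" "cp_box (Suc a) b"] int by simp
  qed
  have "?gf ?F = fps_X ^ (Suc a + Suc b) * ?gf (cp_box (Suc a) (Suc b))"
    using assms by (intro gf_full_box) auto
  then have "(1 - fps_X ^ (Suc a + Suc b)) * ?gf (cp_box (Suc a) (Suc b))
      = ?gf (cp_box (Suc a) (Suc b)) - ?gf ?F"
    by (simp only: left_diff_distrib mult_1_left)
  also have "\<dots> = ?gf ?G"
    by (simp only: V add_diff_cancel_left')
  also have "\<dots> = ?gf (cp_box a (Suc b)) + ?gf (cp_box (Suc a) b) - ?gf (cp_box a b)"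
    by (simp only: flip: G) simp
  finally show ?thesis .
qed

text \<open>The third hypothesis says that attaining the first bound forces attaining the second, so
  what remains beside the full pairs is the single box \<open>cp_box a b\<close>.\<close>

lemma gf_cp_box_Suc_left:
  assumes "a \<le> Suc b" and "b \<le> a + 3"
    and "\<And>\<Lambda>. \<Lambda> \<in> cp_box (Suc a) b \<Longrightarrow> length (\<Lambda> ! 0) = Suc a \<Longrightarrow> length (\<Lambda> ! 1) = b"
  shows "(1 - fps_X ^ (Suc a + b)) * gf (cp_box (Suc a) b) = (gf (cp_box a b) :: 'a :: comm_ring_1 fps)"
proof -
  let ?gf = "gf :: _ \<Rightarrow> 'a fps"
  let ?F = "{\<Lambda> \<in> cp_box (Suc a) b. length (\<Lambda> ! 0) = Suc a \<and> length (\<Lambda> ! 1) = b}"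
  have "cp_box (Suc a) b = ?F \<union> cp_box a b" "?F \<inter> cp_box a b = {}"
    using assms(3) by (auto simp: cp_box_def le_Suc_eq)
  then have V: "?gf (cp_box (Suc a) b) = ?gf ?F + ?gf (cp_box a b)"
    using gf_Un[of ?F "cp_box a b"] finite_cp_box_of_size[of "Suc a" b] by simp
  have "?gf ?F = fps_X ^ (Suc a + b) * ?gf (cp_box (Suc a) b)"
    using assms by (intro gf_full_box) auto
  then have "(1 - fps_X ^ (Suc a + b)) * ?gf (cp_box (Suc a) b) = ?gf (cp_box (Suc a) b) - ?gf ?F"
    by (simp only: left_diff_distrib mult_1_left)
  also have "\<dots> = ?gf (cp_box a b)"
    by (simp only: V add_diff_cancel_left')
  finally show ?thesis .
qed

text \<open>Interlacing gives a second length of at least b once the first is b + 2. This relation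
  closes the system on V(m,m) and V(m+1,m).\<close>

lemma gf_cp_box_boundary:
  "(1 - fps_X ^ (2 * b + 2)) * gf (cp_box (Suc (Suc b)) b) = gf (cp_box (Suc b) b)"
proof -
  have "length (\<Lambda> ! 1) = b" if "\<Lambda> \<in> cp_box (Suc (Suc b)) b" "length (\<Lambda> ! 0) = Suc (Suc b)" for \<Lambda>
    using that interlaced_length by (fastforce simp: mem_cp_box_iff)
  then show ?thesis
    using gf_cp_box_Suc_left[of "Suc b" b] by (simp add: mult_2)
qed

lemma gf_cp_box_10: "(1 - fps_X) * gf (cp_box 1 0) = gf (cp_box 0 0)"
proof -
  have "length (\<Lambda> ! 1) = 0" if "\<Lambda> \<in> cp_box (Suc 0) 0" for \<Lambda>
    using that by (auto simp: cp_box_def)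
  then show ?thesis
    using gf_cp_box_Suc_left[of 0 0] by simp
qed

lemma gf_cp_box_00: "gf (cp_box 0 0) = 1"
proof (rule fps_ext)
  fix n
  have eq: "\<Lambda> \<in> cp_box 0 0 \<and> cp_size \<Lambda> = n \<longleftrightarrow> \<Lambda> = [[], []] \<and> n = 0" for \<Lambda>
    by (auto simp: cp_size_def mem_cp_box_iff interlaced_def part_def is_partition_def)
  have "{\<Lambda> \<in> cp_box 0 0. cp_size \<Lambda> = n} = (if n = 0 then {[[], []]} else {})"
    unfolding eq by simp
  then show "gf (cp_box 0 0) $ n = 1 $ n"
    unfolding gf_def fps_nth_Abs_fps by simp
qed

text \<open>Reversing the pair preserves the conditions, as the profile is symmetric.\<close>

lemma gf_cp_box_commute: "gf (cp_box a b) = gf (cp_box b a)"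
proof -
  have "cp_box a b = rev ` cp_box b a"
  proof (intro equalityI subsetI)
    fix \<Lambda> assume "\<Lambda> \<in> cp_box a b"
    then have "rev \<Lambda> \<in> cp_box b a"
      by (auto simp: mem_cp_box_iff)
    then show "\<Lambda> \<in> rev ` cp_box b a"
      by (metis image_eqI rev_rev_ident)
  qed (auto simp: mem_cp_box_iff)
  moreover have "cp_size (rev \<Lambda>) = 0 + cp_size \<Lambda>" for \<Lambda>
    by (simp add: cp_size_def rev_map flip: rev_map)
  ultimately show ?thesis
    using gf_image[of rev "cp_box b a" 0] by simp
qed

text \<open>In size n all lengths are at most n, so the coefficient of degree n is final once m >=
  n.\<close>

lemma gf_cp_box_tendsto:
  "(\<lambda>m. gf (cp_box m m)) \<longlonglongrightarrow> gf (cylindric_partitions [2, 2])"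
proof (rule tendsto_fpsI)
  fix n
  have eq: "{\<Lambda> \<in> cp_box m m. cp_size \<Lambda> = n} = {\<Lambda> \<in> cylindric_partitions [2, 2]. cp_size \<Lambda> = n}"
    if "n \<le> m" for m
  proof -
    have "\<Lambda> \<in> cp_box m m" if \<Lambda>: "\<Lambda> \<in> cylindric_partitions [2, 2]" "cp_size \<Lambda> = n" for \<Lambda>
    proof -
      obtain \<mu> \<nu> where \<mu>\<nu>: "\<Lambda> = [\<mu>, \<nu>]" "is_partition \<mu>" "is_partition \<nu>"
        using \<Lambda> cylindric_partitions_22_iff by blast
      then have "length \<mu> \<le> m" "length \<nu> \<le> m"
        using partition_length_le[of \<mu>] partition_length_le[of \<nu>] \<Lambda>(2) \<open>n \<le> m\<close>
        by (auto simp: cp_size_def)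
      then show ?thesis
        using \<Lambda>(1) \<mu>\<nu>(1) by (simp add: cp_box_def)
    qed
    then show ?thesis
      by (auto simp: cp_box_def)
  qed
  show "\<forall>\<^sub>F m in sequentially. gf (cp_box m m) $ n = gf (cylindric_partitions [2, 2]) $ n"
    using eventually_ge_at_top[of n] by eventually_elim (simp add: gf_def eq)
qed

subsection \<open>Recurrences for the numerators\<close>

text \<open>This is \<alpha>_m, and \<open>offdiag_num\<close> is \<beta>_m; the Pochhammer factors
  clear the denominators 1 - q^(a+b) that the recurrences produce.\<close>

definition diag_num :: "nat \<Rightarrow> 'a :: comm_ring_1 fps" where
  "diag_num m = qpoch fps_X fps_X (2 * m) * gf (cp_box m m)"

text \<open>The value at index 0 is chosen so that the recurrences below hold from index 0 on.\<close>
definition offdiag_num :: "nat \<Rightarrow> 'a :: comm_ring_1 fps" where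
  "offdiag_num m = (if m = 0 then 0 else qpoch fps_X fps_X (2 * m - 1) * gf (cp_box m (m - 1)))"

text \<open>The interior recurrence for V(m+1,m) involves V(m+1,m-1), which the boundary relation
  trades for V(m,m-1). For m = 0 there is no such term and V(1,0) is computed directly.\<close>

lemma offdiag_num_Suc: "offdiag_num (Suc m) = diag_num m + fps_X ^ (2 * m) * offdiag_num m"
proof (cases m)
  case 0
  then show ?thesis
    using gf_cp_box_10 by (simp add: diag_num_def offdiag_num_def qpoch_Suc gf_cp_box_00)
next
  case (Suc k)
  let ?V = "\<lambda>a b. gf (cp_box a b) :: 'a fps"
  define P :: "'a fps" where "P = qpoch fps_X fps_X (Suc (2 * k))"
  define u v :: "'a fps" where "u = fps_X ^ (2 * k + 2)" and "v = fps_X ^ (2 * k + 3)"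
  have rec: "(1 - v) * ?V (Suc (Suc k)) (Suc k)
      = ?V (Suc k) (Suc k) + ?V (Suc (Suc k)) k - ?V (Suc k) k"
    using gf_cp_box_Suc_Suc[of "Suc k" k] unfolding v_def
    by (simp add: eval_nat_numeral mult_2)
  have bd: "(1 - u) * ?V (Suc (Suc k)) k = ?V (Suc k) k"
    using gf_cp_box_boundary[of k] by (simp add: u_def)
  have "offdiag_num (Suc m) = P * (1 - u) * (1 - v) * ?V (Suc (Suc k)) (Suc k)"
    by (simp add: offdiag_num_def Suc P_def u_def v_def qpoch_Suc eval_nat_numeral mult_ac)
  moreover have "diag_num m = P * (1 - u) * ?V (Suc k) (Suc k)"
    by (simp add: diag_num_def Suc P_def u_def qpoch_Suc eval_nat_numeral mult_ac)
  moreover have "fps_X ^ (2 * m) * offdiag_num m = u * P * ?V (Suc k) k"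
    by (simp add: offdiag_num_def Suc P_def u_def mult_ac)
  moreover have "P * (1 - u) * (1 - v) * ?V (Suc (Suc k)) (Suc k)
      = P * (1 - u) * ?V (Suc k) (Suc k) + u * P * ?V (Suc k) k"
  proof -
    have "P * (1 - u) * (1 - v) * ?V (Suc (Suc k)) (Suc k)
        = P * (1 - u) * (?V (Suc k) (Suc k) + ?V (Suc (Suc k)) k - ?V (Suc k) k)"
      by (simp only: mult.assoc rec)
    also have "\<dots> = P * (1 - u) * ?V (Suc k) (Suc k)
        + P * ((1 - u) * ?V (Suc (Suc k)) k) - P * (1 - u) * ?V (Suc k) k"
      by (simp add: algebra_simps)
    \<comment> \<open>By \<open>bd\<close> the middle term is P V(k+1,k), and P - P (1 - u) = u
      P.\<close>
    also have "\<dots> = P * (1 - u) * ?V (Suc k) (Suc k) + u * P * ?V (Suc k) k"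
      unfolding bd by (simp add: algebra_simps)
    finally show ?thesis .
  qed
  ultimately show ?thesis
    by simp
qed

text \<open>By symmetry the two off-diagonal terms agree, so \<alpha>_(m+1) = 2 \<beta>_(m+1) - (1 -
  q^(2m+1)) \<alpha>_m; then \<beta>_(m+1) is eliminated with
  \<open>offdiag_num_Suc\<close>.\<close>

lemma diag_num_Suc:
  "diag_num (Suc m) = (1 + fps_X ^ (2 * m + 1)) * diag_num m + 2 * fps_X ^ (2 * m) * offdiag_num m"
proof -
  let ?V = "\<lambda>a b. gf (cp_box a b) :: 'a fps"
  define P :: "'a fps" where "P = qpoch fps_X fps_X (2 * m)"
  define u v :: "'a fps" where "u = fps_X ^ (2 * m + 1)" and "v = fps_X ^ (2 * m + 2)"
  have rec: "(1 - v) * ?V (Suc m) (Suc m) = 2 * ?V (Suc m) m - ?V m m"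
  proof -
    have "(1 - v) * ?V (Suc m) (Suc m) = ?V m (Suc m) + ?V (Suc m) m - ?V m m"
      using gf_cp_box_Suc_Suc[of m m] by (simp add: v_def mult_2)
    also have "?V m (Suc m) = ?V (Suc m) m"
      by (rule gf_cp_box_commute)
    finally show ?thesis
      by (simp only: mult_2)
  qed
  have "diag_num (Suc m) = P * (1 - u) * (1 - v) * ?V (Suc m) (Suc m)"
    by (simp add: diag_num_def P_def u_def v_def qpoch_Suc mult_ac)
  moreover have "offdiag_num (Suc m) = P * (1 - u) * ?V (Suc m) m"
    by (simp add: offdiag_num_def P_def u_def qpoch_Suc mult_ac)
  moreover have "diag_num m = P * ?V m m"
    by (simp add: diag_num_def P_def)
  moreover have "P * (1 - u) * (1 - v) * ?V (Suc m) (Suc m)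
      = P * (1 - u) * (2 * ?V (Suc m) m - ?V m m)"
    by (simp only: mult.assoc rec)
  moreover have "\<dots> = 2 * (P * (1 - u) * ?V (Suc m) m) - (1 - u) * (P * ?V m m)"
    by (simp add: algebra_simps)
  ultimately have "diag_num (Suc m) = 2 * offdiag_num (Suc m) - (1 - u) * diag_num m"
    by simp
  also have "\<dots> = (1 + u) * diag_num m + 2 * fps_X ^ (2 * m) * offdiag_num m"
    by (simp add: offdiag_num_Suc algebra_simps)
  finally show ?thesis
    by (simp add: u_def)
qed

lemma diag_num_tendsto: "diag_num \<longlonglongrightarrow> qpoch_inf fps_X fps_X * gf (cylindric_partitions [2, 2])"
proof -
  have "(\<lambda>m. qpoch fps_X fps_X (2 * m)) \<longlonglongrightarrow> (qpoch_inf fps_X fps_X :: 'a fps)"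
    by (rule filterlim_compose[OF qpoch_tendsto])
       (simp_all add: filterlim_subseq strict_mono_def)
  then show ?thesis
    unfolding diag_num_def[abs_def] using gf_cp_box_tendsto by (rule tendsto_fps_mult)
qed

subsection \<open>The dual series\<close>

definition dual_coeff :: "nat \<Rightarrow> 'a :: field fps" where
  "dual_coeff n = fps_X ^ (n * (n + 1)) * qpoch (- 1) (fps_X\<^sup>2) n * inverse (qpoch (fps_X\<^sup>2) (fps_X\<^sup>2) n)"

text \<open>
  This is $(-q^{2k+1};q^2)_\infty$, so that \<open>dual_term k n\<close> below is
  $t_n q^{2kn} (-q^{2k+2n+1};q^2)_\infty$.
\<close>
definition odd_tail :: "nat \<Rightarrow> 'a :: field fps" where
  "odd_tail k = qpoch_inf (- fps_X) (fps_X\<^sup>2) * inverse (qpoch (- fps_X) (fps_X\<^sup>2) k)"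

definition dual_term :: "nat \<Rightarrow> nat \<Rightarrow> 'a :: field fps" where
  "dual_term k n = dual_coeff n * fps_X ^ (2 * k * n) * odd_tail (k + n)"

text \<open>This is X_k, written with finite sums because the n-th term starts in degree n or
  later.\<close>

definition dual_series :: "nat \<Rightarrow> 'a :: field fps" where
  "dual_series k = Abs_fps (\<lambda>i. \<Sum>n\<le>i. dual_term k n $ i)"

lemma dual_coeff_0 [simp]: "dual_coeff 0 = 1"
  by (simp add: dual_coeff_def)

text \<open>The exponent n(n+1) grows by 2n + 2 and the new factor of (-1;q^2)_(n+1) is 1 + q^(2n).
  The denominator is multiplied out so that later computations stay polynomial.\<close>

lemma dual_coeff_Suc:
  "dual_coeff (Suc n) * (1 - fps_X ^ (2 * n + 2)) = dual_coeff n * fps_X ^ (2 * n + 2) * (1 + fps_X ^ (2 * n))"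
proof -
  define P :: "'a fps" where "P = qpoch (fps_X\<^sup>2) (fps_X\<^sup>2) n"
  define c :: "'a fps" where "c = 1 - fps_X ^ (2 * n + 2)"
  have c: "inverse c * c = 1"
    by (rule inverse_mult_eq_1) (simp add: c_def)
  have "fps_X\<^sup>2 * (fps_X\<^sup>2) ^ n = (fps_X ^ (2 * n + 2) :: 'a fps)"
    by (simp add: power_mult[symmetric] flip: power_add)
  then have P: "qpoch (fps_X\<^sup>2) (fps_X\<^sup>2) (Suc n) = P * c"
    by (simp only: qpoch_Suc P_def c_def)
  have "dual_coeff (Suc n) * c = fps_X ^ (Suc n * (Suc n + 1)) * qpoch (- 1) (fps_X\<^sup>2) (Suc n)
      * inverse P * (inverse c * c)"
    unfolding dual_coeff_def P by (simp add: fps_inverse_mult mult_ac)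
  also have "\<dots> = fps_X ^ (n * (n + 1) + (2 * n + 2)) * qpoch (- 1) (fps_X\<^sup>2) n
      * (1 + fps_X ^ (2 * n)) * inverse P"
  proof -
    have "Suc n * (Suc n + 1) = n * (n + 1) + (2 * n + 2)"
      by simp
    moreover have "qpoch (- 1) (fps_X\<^sup>2) (Suc n)
        = qpoch (- 1) (fps_X\<^sup>2) n * (1 + fps_X ^ (2 * n) :: 'a fps)"
      by (simp add: qpoch_Suc power_mult)
    ultimately show ?thesis
      by (simp only: c mult_1_right mult.assoc)
  qed
  also have "\<dots> = dual_coeff n * fps_X ^ (2 * n + 2) * (1 + fps_X ^ (2 * n))"
    unfolding dual_coeff_def P_def power_add by (simp only: mult_ac)
  finally show ?thesis
    by (simp add: c_def)
qed

lemma odd_tail_rec: "odd_tail k = (1 + fps_X ^ (2 * k + 1)) * odd_tail (Suc k)"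
proof -
  define c :: "'a fps" where "c = 1 + fps_X ^ (2 * k + 1)"
  have c: "inverse c * c = 1"
    by (rule inverse_mult_eq_1) (simp add: c_def)
  have "qpoch (- fps_X) (fps_X\<^sup>2) (Suc k) = qpoch (- fps_X) (fps_X\<^sup>2) k * c"
    by (simp add: qpoch_Suc c_def power_mult)
  then have "c * odd_tail (Suc k) = odd_tail k * (inverse c * c)"
    by (simp add: odd_tail_def fps_inverse_mult mult_ac)
  also have "\<dots> = odd_tail k"
    by (simp only: c mult_1_right)
  finally show ?thesis
    by (simp only: c_def)
qed

lemma odd_tail_tendsto: "odd_tail \<longlonglongrightarrow> 1"
proof -
  have nz: "(qpoch_inf (- fps_X) (fps_X\<^sup>2) :: 'a fps) $ 0 \<noteq> 0"
    by (subst qpoch_inf_nth_0) auto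
  have "(\<lambda>k. inverse (qpoch (- fps_X) (fps_X\<^sup>2) k))
      \<longlonglongrightarrow> inverse (qpoch_inf (- fps_X) (fps_X\<^sup>2) :: 'a fps)"
    by (intro tendsto_inverse_fps qpoch_tendsto nz) simp
  from tendsto_fps_mult[OF tendsto_const this, of "qpoch_inf (- fps_X) (fps_X\<^sup>2)"]
  show ?thesis
    using inverse_mult_eq_1'[OF nz] by (simp add: odd_tail_def[abs_def])
qed

text \<open>Splitting n(n+1) = n n + n exposes a factor q^n, which gives a bound uniform in
  k.\<close>

lemma dual_term_nth_eq_0:
  assumes "i < n"
  shows "dual_term k n $ i = 0"
proof -
  have "dual_term k n = (qpoch (- 1) (fps_X\<^sup>2) n * inverse (qpoch (fps_X\<^sup>2) (fps_X\<^sup>2) n)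
      * fps_X ^ (2 * k * n) * odd_tail (k + n) * fps_X ^ (n * n)) * fps_X ^ n"
    by (simp add: dual_term_def dual_coeff_def power_add mult_ac)
  then show ?thesis
    using assms by (metis fps_mult_power_nth_eq_0 fps_X_nth zero_neq_one)
qed

lemma dual_series_tendsto: "(\<lambda>N. \<Sum>n<N. dual_term k n) \<longlonglongrightarrow> dual_series k"
  unfolding dual_series_def by (intro fps_partial_sums_tendsto dual_term_nth_eq_0)

text \<open>The recurrence for X_k holds term by term after shifting n by one: up to a common
  factor, the two sides are those of \<open>dual_coeff_Suc\<close>.\<close>

lemma dual_term_telescope:
  "dual_term k (Suc n) - (1 + fps_X ^ (2 * k + 1)) * dual_term (Suc k) (Suc n)
     = fps_X ^ (2 * k + 2) * (dual_term (Suc k) n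
         + (1 - fps_X ^ (2 * k + 3)) * dual_term (Suc (Suc k)) n)"
proof -
  \<comment> \<open>All tails are expressed through the shortest one, \<open>d\<close>; the longer
    ones have the extra factor 1 + q^(2k+2n+3) = 1 + a p w.\<close>
  define a p z w d :: "'a fps" where "a = fps_X ^ (2 * k + 1)" and "p = fps_X ^ (2 * n)"
    and "z = fps_X ^ (2 * k * n)" and "w = fps_X\<^sup>2" and "d = odd_tail (k + n + 2)"
  have D1: "odd_tail (k + Suc n) = (1 + a * p * w) * d"
    using odd_tail_rec[of "k + Suc n"] by (simp add: a_def p_def w_def d_def power_add algebra_simps eval_nat_numeral)
  have t1: "dual_coeff (Suc n) * (1 - p * w) = dual_coeff n * p * w * (1 + p)"
    using dual_coeff_Suc[of n] unfolding p_def w_def power_add by (simp only: mult.assoc)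
  have D2: "odd_tail (Suc k + n) = (1 + a * p * w) * d"
    using D1 by simp
  have "dual_term k (Suc n) = dual_coeff (Suc n) * z * fps_X ^ (2 * k) * ((1 + a * p * w) * d)"
    unfolding dual_term_def D1 by (simp add: z_def power_add algebra_simps)
  moreover have "dual_term (Suc k) (Suc n) = dual_coeff (Suc n) * z * fps_X ^ (2 * k) * p * w * d"
    by (simp add: dual_term_def z_def p_def w_def d_def power_add algebra_simps eval_nat_numeral)
  moreover have "dual_term (Suc k) n = dual_coeff n * z * p * ((1 + a * p * w) * d)"
    unfolding dual_term_def D2 by (simp add: z_def p_def power_add algebra_simps)
  moreover have "dual_term (Suc (Suc k)) n = dual_coeff n * z * p * p * d"
    by (simp add: dual_term_def z_def p_def d_def power_add algebra_simps eval_nat_numeral)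
  moreover have X: "fps_X ^ (2 * k + 2) = fps_X ^ (2 * k) * w" "fps_X ^ (2 * k + 3) = a * w"
    by (simp_all add: a_def w_def power_add eval_nat_numeral algebra_simps)
  \<comment> \<open>The variable a cancels: (1 + apw) - (1 + a)pw = 1 - pw and (1 + apw) + (1 - aw)p
    = 1 + p.\<close>
  ultimately have "dual_term k (Suc n) - (1 + a) * dual_term (Suc k) (Suc n)
      = (dual_coeff (Suc n) * (1 - p * w)) * (z * fps_X ^ (2 * k) * d)"
    and "fps_X ^ (2 * k) * w * (dual_term (Suc k) n + (1 - a * w) * dual_term (Suc (Suc k)) n)
      = (dual_coeff n * p * w * (1 + p)) * (z * fps_X ^ (2 * k) * d)"
    by (simp_all add: algebra_simps)
  then show ?thesis
    by (simp only: X t1 flip: a_def)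
qed

lemma dual_series_rec:
  "dual_series k = (1 + fps_X ^ (2 * k + 1)) * dual_series (Suc k)
     + fps_X ^ (2 * k + 2) * (dual_series (Suc k)
         + (1 - fps_X ^ (2 * k + 3)) * dual_series (Suc (Suc k)))"
proof (rule LIMSEQ_unique)
  let ?S = "\<lambda>k N. \<Sum>n<N. dual_term k n :: 'a fps"
  have lim: "(\<lambda>N. ?S k (Suc N)) \<longlonglongrightarrow> dual_series k" for k
    by (rule LIMSEQ_Suc[OF dual_series_tendsto])
  show "(\<lambda>N. ?S k (Suc N)) \<longlonglongrightarrow> dual_series k"
    by (rule lim)
  have "?S k (Suc N) = (1 + fps_X ^ (2 * k + 1)) * ?S (Suc k) (Suc N)
     + fps_X ^ (2 * k + 2) * (?S (Suc k) N + (1 - fps_X ^ (2 * k + 3)) * ?S (Suc (Suc k)) N)" for N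
  proof -
    \<comment> \<open>The shift leaves the terms n = 0 unmatched on the left; they cancel among
      themselves.\<close>
    have "dual_term k 0 = (1 + fps_X ^ (2 * k + 1)) * dual_term (Suc k) 0"
      using odd_tail_rec[of k] by (simp add: dual_term_def)
    then have "?S k (Suc N) - (1 + fps_X ^ (2 * k + 1)) * ?S (Suc k) (Suc N)
        = (\<Sum>n<N. dual_term k (Suc n) - (1 + fps_X ^ (2 * k + 1)) * dual_term (Suc k) (Suc n))"
      unfolding sum.lessThan_Suc_shift sum_subtractf sum_distrib_left[symmetric] distrib_left
      by simp
    also have "\<dots> = fps_X ^ (2 * k + 2)
        * (?S (Suc k) N + (1 - fps_X ^ (2 * k + 3)) * ?S (Suc (Suc k)) N)"
      unfolding dual_term_telescope
      by (simp only: sum.distrib sum_distrib_left[symmetric])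
    finally show ?thesis
      by (simp only: diff_eq_eq add.commute)
  qed
  moreover have "(\<lambda>N. (1 + fps_X ^ (2 * k + 1)) * ?S (Suc k) (Suc N)
     + fps_X ^ (2 * k + 2) * (?S (Suc k) N + (1 - fps_X ^ (2 * k + 3)) * ?S (Suc (Suc k)) N))
     \<longlonglongrightarrow> (1 + fps_X ^ (2 * k + 1)) * dual_series (Suc k)
     + fps_X ^ (2 * k + 2) * (dual_series (Suc k)
         + (1 - fps_X ^ (2 * k + 3)) * dual_series (Suc (Suc k)))"
    by (intro tendsto_fps_add tendsto_fps_mult tendsto_const lim dual_series_tendsto)
  ultimately show "(\<lambda>N. ?S k (Suc N)) \<longlonglongrightarrow> (1 + fps_X ^ (2 * k + 1)) * dual_series (Suc k)
     + fps_X ^ (2 * k + 2) * (dual_series (Suc k)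
         + (1 - fps_X ^ (2 * k + 3)) * dual_series (Suc (Suc k)))"
    by presburger
qed

text \<open>For k > i the factor q^(2kn) pushes all terms with n >= 1 beyond degree i, leaving
  \<open>odd_tail k\<close>, which tends to 1.\<close>

lemma dual_series_tendsto_1: "dual_series \<longlonglongrightarrow> 1"
proof (rule tendsto_fpsI)
  fix i
  have "\<forall>\<^sub>F k in sequentially. odd_tail k $ i = (1 :: 'a fps) $ i"
    using odd_tail_tendsto unfolding tendsto_fps_iff by blast
  then show "\<forall>\<^sub>F k in sequentially. dual_series k $ i = (1 :: 'a fps) $ i"
    using eventually_gt_at_top[of i]
  proof eventually_elim
    case (elim k)
    have "dual_term k n $ i = 0" if "n \<noteq> 0" for n
    proof -
      have "i < 2 * k * n"
        using elim(2) that by (cases n) auto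
      moreover have "dual_term k n = (dual_coeff n * odd_tail (k + n)) * fps_X ^ (2 * k * n)"
        by (simp add: dual_term_def mult_ac)
      ultimately show ?thesis
        by (metis fps_mult_power_nth_eq_0 fps_X_nth zero_neq_one)
    qed
    then have "dual_series k $ i = (\<Sum>n\<in>{0}. dual_term k n $ i)"
      unfolding dual_series_def fps_nth_Abs_fps by (intro sum.mono_neutral_right) auto
    then have "dual_series k $ i = odd_tail k $ i"
      by (simp add: dual_term_def)
    then show ?case
      using elim(1) by (rule trans)
  qed
qed

section \<open>Pairing the numerators with the dual series\<close>

text \<open>
  The transposed recurrence: the pairing of the numerators at step \<open>k\<close> with the dual series does
  not depend on \<open>k\<close>.
\<close>
lemma diag_num_dual_invariant:
  "dual_series (Suc k) * diag_num (Suc k)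
     + fps_X ^ (2 * k + 2) * (dual_series (Suc k)
         + (1 - fps_X ^ (2 * k + 3)) * dual_series (Suc (Suc k))) * offdiag_num (Suc k)
   = dual_series 0"
proof (induction k)
  case 0
  \<comment> \<open>These values give \<alpha>_1 = 1 + q and \<beta>_1 = 1, so the claim is the
    recurrence for X_0.\<close>
  have "diag_num 0 = (1 :: 'a fps)" "offdiag_num 0 = (0 :: 'a fps)"
    by (simp_all add: diag_num_def offdiag_num_def gf_cp_box_00)
  then show ?case
    using dual_series_rec[of 0, where 'a = 'a] by (simp add: diag_num_Suc offdiag_num_Suc mult_ac)
next
  case (Suc k)
  define X1 X2 X3 u :: "'a fps" where "X1 = dual_series (Suc k)"
    and "X2 = dual_series (Suc (Suc k))" and "X3 = dual_series (Suc (Suc (Suc k)))"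
    and "u = fps_X ^ (2 * k + 2)"
  have u: "fps_X ^ (2 * k + 3) = u * fps_X" "fps_X ^ (2 * Suc k + 1) = u * fps_X"
    "fps_X ^ (2 * Suc k) = u" "fps_X ^ (2 * Suc k + 2) = u * fps_X * fps_X"
    "fps_X ^ (2 * Suc k + 3) = u * fps_X * fps_X * fps_X"
    by (simp_all add: u_def power_add eval_nat_numeral algebra_simps)
  have rec: "X1 = (1 + u * fps_X) * X2 + u * fps_X * fps_X * (X2 + (1 - u * fps_X * fps_X * fps_X) * X3)"
    using dual_series_rec[of "Suc k", where 'a = 'a]
    unfolding u X1_def[symmetric] X2_def[symmetric] X3_def[symmetric] .
  \<comment> \<open>Replacing the coefficient of \<beta>_(k+2) by this removes X3; expanding
    \<alpha>_(k+2) and \<beta>_(k+2) then returns the induction hypothesis.\<close>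
  then have rec': "u * fps_X * fps_X * (X2 + (1 - u * fps_X * fps_X * fps_X) * X3)
      = X1 - (1 + u * fps_X) * X2"
    by (simp only: add_diff_cancel_left')
  show ?case
    using Suc.IH
    unfolding diag_num_Suc[of "Suc k"] offdiag_num_Suc[of "Suc k"] u
      X1_def[symmetric] X2_def[symmetric] X3_def[symmetric] u_def[symmetric] rec'
    by (simp add: algebra_simps)
qed

text \<open>In the invariant the \<beta> part carries q^(2k+2) and leaves every fixed degree, while
  the \<alpha> part tends to lim \<alpha>_m because X_k tends to 1.\<close>

lemma dual_series_0:
  "dual_series 0 = qpoch_inf fps_X fps_X * gf (cylindric_partitions [2, 2])"
    (is "_ = ?L")
proof (rule fps_ext)
  fix i
  have "(\<lambda>k. dual_series (Suc k) * diag_num (Suc k)) \<longlonglongrightarrow> 1 * ?L"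
    using LIMSEQ_Suc[OF dual_series_tendsto_1] LIMSEQ_Suc[OF diag_num_tendsto] by (rule tendsto_fps_mult)
  then have "\<forall>\<^sub>F k in sequentially. (dual_series (Suc k) * diag_num (Suc k)) $ i = ?L $ i"
    by (simp add: tendsto_fps_iff)
  then have "\<forall>\<^sub>F k in sequentially. dual_series 0 $ i = ?L $ i"
    using eventually_gt_at_top[of i]
  proof eventually_elim
    case (elim k)
    let ?Y = "(dual_series (Suc k) + (1 - fps_X ^ (2 * k + 3)) * dual_series (Suc (Suc k)))
      * offdiag_num (Suc k) :: 'a fps"
    have "dual_series 0 = dual_series (Suc k) * diag_num (Suc k) + ?Y * fps_X ^ (2 * k + 2)"
      by (subst diag_num_dual_invariant[of k, symmetric]) (simp only: mult_ac)
    moreover have "(?Y * fps_X ^ (2 * k + 2)) $ i = 0"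
      using elim(2) by (intro fps_mult_power_nth_eq_0) auto
    ultimately show ?case
      using elim(1) by (simp only: fps_add_nth add_0_right)
  qed
  then show "dual_series 0 $ i = ?L $ i"
    by simp
qed

section \<open>From the dual series to the closed formula\<close>

lemma dual_coeff_eq:
  assumes "n \<noteq> 0"
  shows "dual_coeff n = 2 * fps_X ^ (n * (n + 1)) * qpoch (- (fps_X\<^sup>2)) (fps_X\<^sup>2) (n - 1)
           * inverse (qpoch (fps_X\<^sup>2) (fps_X\<^sup>2) n)"
proof -
  obtain m where n: "n = Suc m"
    using assms not0_implies_Suc by blast
  \<comment> \<open>The first factor of (-1;q^2)_(m+1) is 1 + 1, the source of the 2 in the
    formula.\<close>
  have "qpoch (- 1) (fps_X\<^sup>2) (Suc m) = 2 * qpoch (- (fps_X\<^sup>2) :: 'a fps) (fps_X\<^sup>2) m"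
    by (induction m) (simp_all add: qpoch_Suc mult_ac)
  then show ?thesis
    unfolding dual_coeff_def n by (simp only: diff_Suc_1 mult_ac)
qed

theorem theorem5p2:
  fixes q :: "rat fps"
  defines "q \<equiv> fps_X"
  shows "((\<lambda>\<Lambda>. q ^ cp_size \<Lambda>) has_sum
           (1 + (\<Sum>\<^sub>\<infinity>n\<in>{1..}.
                   2 * q ^ (n * (n + 1)) * qpoch (- (q ^ 2)) (q ^ 2) (n - 1) /
                   (qpoch (q ^ 2) (q ^ 2) n * qpoch (- q) (q ^ 2) n))) *
           (qpoch_inf (- q) (q ^ 2) / qpoch_inf q q))
         (cylindric_partitions [2, 2])"
proof -
  let ?s = "\<lambda>n. 2 * q ^ (n * (n + 1)) * qpoch (- (q ^ 2)) (q ^ 2) (n - 1) /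
                   (qpoch (q ^ 2) (q ^ 2) n * qpoch (- q) (q ^ 2) n)"
  \<comment> \<open>This is t_n / (-q;q^2)_n: its value 1 at n = 0 is the leading 1 of the formula,
    and for n >= 1 it equals the summand.\<close>
  define w where "w n = dual_coeff n * inverse (qpoch (- q) (q\<^sup>2) n)" for n
  have nth_0: "qpoch (q\<^sup>2) (q\<^sup>2) n $ 0 = 1" "qpoch (- q) (q\<^sup>2) n $ 0 = 1"
    "qpoch_inf q q $ 0 = 1" for n
    by (simp_all add: qpoch_nth_0 qpoch_inf_nth_0 q_def)
  have s_eq: "?s n = w n" if "n \<in> {1..}" for n
    using that nth_0
    by (simp add: w_def dual_coeff_eq fps_divide_unit fps_inverse_mult mult_ac flip: q_def)
  have w_nth: "w n $ i = 0" if "i < n" for n i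
  proof -
    have "w n = (qpoch (- 1) (q\<^sup>2) n * inverse (qpoch (q\<^sup>2) (q\<^sup>2) n)
        * inverse (qpoch (- q) (q\<^sup>2) n) * q ^ (n * n)) * q ^ n"
      by (simp add: w_def dual_coeff_def power_add mult_ac flip: q_def)
    moreover have "q $ 0 = 0"
      by (simp add: q_def)
    ultimately show ?thesis
      using that by (metis fps_mult_power_nth_eq_0)
  qed
  have "(w has_sum Abs_fps (\<lambda>i. \<Sum>n\<in>{1..} \<inter> {..i}. w n $ i)) {1..}"
    by (intro fps_has_sum_of_subdegree w_nth)
  also have "?this \<longleftrightarrow> (?s has_sum Abs_fps (\<lambda>i. \<Sum>n\<in>{1..} \<inter> {..i}. w n $ i)) {1..}"
    by (intro has_sum_cong s_eq[symmetric])
  finally have "(?s has_sum Abs_fps (\<lambda>i. \<Sum>n\<in>{1..} \<inter> {..i}. w n $ i)) {1..}" .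
  then have "1 + (\<Sum>\<^sub>\<infinity>n\<in>{1..}. ?s n) = 1 + Abs_fps (\<lambda>i. \<Sum>n\<in>{1..} \<inter> {..i}. w n $ i)"
    by (simp only: infsumI)
  also have "\<dots> = Abs_fps (\<lambda>i. \<Sum>n\<le>i. w n $ i)"
  proof (rule fps_ext)
    fix i :: nat
    have eq: "{..i} = insert 0 ({1..} \<inter> {..i})"
      by (auto simp: Suc_le_eq)
    have "(\<Sum>n\<le>i. w n $ i) = w 0 $ i + (\<Sum>n\<in>{1..} \<inter> {..i}. w n $ i)"
      by (subst eq, subst sum.insert) auto
    then show "(1 + Abs_fps (\<lambda>i. \<Sum>n\<in>{1..} \<inter> {..i}. w n $ i)) $ i = Abs_fps (\<lambda>i. \<Sum>n\<le>i. w n $ i) $ i"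
      by (simp add: w_def)
  qed
  finally have W: "(\<lambda>N. \<Sum>n<N. w n) \<longlonglongrightarrow> 1 + (\<Sum>\<^sub>\<infinity>n\<in>{1..}. ?s n)"
    by (simp only:) (intro fps_partial_sums_tendsto w_nth)
  have "dual_series 0 = (1 + (\<Sum>\<^sub>\<infinity>n\<in>{1..}. ?s n)) * qpoch_inf (- q) (q\<^sup>2)"
  proof (rule LIMSEQ_unique[OF dual_series_tendsto])
    \<comment> \<open>For k = 0 the tail is (-q;q^2)_\<infinity> / (-q;q^2)_n, so the infinite
      product factors out of the whole sum.\<close>
    have "dual_term 0 n = w n * qpoch_inf (- q) (q\<^sup>2)" for n
      by (simp add: dual_term_def odd_tail_def w_def mult_ac flip: q_def)
    then have "(\<lambda>N. \<Sum>n<N. dual_term 0 n) = (\<lambda>N. (\<Sum>n<N. w n) * qpoch_inf (- q) (q\<^sup>2))"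
      by (simp only: sum_distrib_right)
    then show "(\<lambda>N. \<Sum>n<N. dual_term 0 n)
        \<longlonglongrightarrow> (1 + (\<Sum>\<^sub>\<infinity>n\<in>{1..}. ?s n)) * qpoch_inf (- q) (q\<^sup>2)"
      by (simp only:) (intro tendsto_fps_mult tendsto_const W)
  qed
  then have main: "gf (cylindric_partitions [2, 2]) * qpoch_inf q q
      = (1 + (\<Sum>\<^sub>\<infinity>n\<in>{1..}. ?s n)) * qpoch_inf (- q) (q\<^sup>2)"
    by (simp only: dual_series_0 q_def mult.commute)
  \<comment> \<open>The constant term of (q;q)_\<infinity> is 1, so dividing by it is multiplying by
    its inverse.\<close>
  have unit: "qpoch_inf q q * inverse (qpoch_inf q q) = 1"
    by (rule inverse_mult_eq_1') (simp add: nth_0)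
  have "gf (cylindric_partitions [2, 2])
      = gf (cylindric_partitions [2, 2]) * qpoch_inf q q * inverse (qpoch_inf q q)"
    by (simp only: mult.assoc unit mult_1_right)
  also have "\<dots> = (1 + (\<Sum>\<^sub>\<infinity>n\<in>{1..}. ?s n)) * (qpoch_inf (- q) (q\<^sup>2) * inverse (qpoch_inf q q))"
    by (simp only: main mult.assoc)
  also have "qpoch_inf (- q) (q\<^sup>2) * inverse (qpoch_inf q q) = qpoch_inf (- q) (q\<^sup>2) / qpoch_inf q q"
    by (simp add: fps_divide_unit nth_0)
  finally have total: "gf (cylindric_partitions [2, 2])
      = (1 + (\<Sum>\<^sub>\<infinity>n\<in>{1..}. ?s n)) * (qpoch_inf (- q) (q\<^sup>2) / qpoch_inf q q)" .
  have "((\<lambda>\<Lambda>. q ^ cp_size \<Lambda>) has_sum gf (cylindric_partitions [2, 2]))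
      (cylindric_partitions [2, 2])"
    unfolding q_def by (intro has_sum_gf finite_cylindric_partitions_of_size)
  then show ?thesis
    by (simp only: total)
qed

end
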